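(* Let $\mathcal{P}=\{x\in\mathbb{R}^n:\langle a_i,x\rangle\le b_i\ \forall i\in[m]\}$ be a polytope with $m$ facet inequalities. For any $x_0\in\mathcal{P}$ and $w\in\mathbb{R}^n$, let $g(\lambda)=\Pi_{\mathcal{P}}(x_0-\lambda w)$, $\lambda\in\mathbb{R}_+$, be the projections curve at $x_0$ with respect to $w$. Then this curve is piecewise linear starting at $x_0$: there exist $k$ breakpoints $x_1,\dots,x_k\in\mathcal{P}$, corresponding to projections with $\lambda$ equal to $0=\lambda_0^-\le\lambda_0^+<\lambda_1^-\le\lambda_1^+<\lambda_2^-\le\lambda_2^+<\cdots<\lambda_k^-\le\lambda_k^+$, where (a) $\lambda_i^-=\min\{\lambda\ge 0: g(\lambda)=x_i\}$ and $\lambda_i^+=\max\{\lambda\ge0: g(\lambda)=x_i\}$ for $i\ge 0$ (with $\lambda_k^+=\infty$ at the end point); (b) $g(\lambda)=x_{i-1}+\frac{x_i-x_{i-1}}{\lambda_i^--\lambda_{i-1}^+}(\lambda-\lambda_{i-1}^+)$ for $\lambda\in[\lambda_{i-1}^+,\lambda_i^-]$, for all $i\ge1$. Moreover, for each $1\le i\le k$ and all $\lambda,\lambda'\in(\lambda_{i-1}^+,\lambda_i^-)$: (i) $N_{\mathcal{P}}(x_{i-1})=N_{\mathcal{P}}(g(\lambda_{i-1}^+))\supseteq N_{\mathcal{P}}(g(\lambda))$, and if $\lambda_{i-1}^-<\lambda_{i-1}^+$ then the containment is strict; (ii) $N_{\mathcal{P}}(g(\lambda))=N_{\mathcal{P}}(g(\lambda'))$;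 (iii) $N_{\mathcal{P}}(g(\lambda))\subseteq N_{\mathcal{P}}(g(\lambda_i^-))=N_{\mathcal{P}}(x_i)$. Further: (iv) if $N_{\mathcal{P}}(g(\lambda))=N_{\mathcal{P}}(g(\lambda'))$ for some $\lambda<\lambda'$, then the curve between $g(\lambda)$ and $g(\lambda')$ is linear, i.e. $g(\delta\lambda+(1-\delta)\lambda')=\delta g(\lambda)+(1-\delta)g(\lambda')$ for all $\delta\in[0,1]$; (v) the number of breakpoints of $g$ is at most the number of faces of $\mathcal{P}$; (vi) $\lim_{\lambda\to\infty}g(\lambda)=x_k\in\arg\min_{x\in\mathcal{P}}\langle x,w\rangle$; in fact $x_k$ minimizes $\|y-x_0\|$ over $y\in\arg\min_{x\in\mathcal{P}}\langle x,w\rangle$.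
   Context: $\|\cdot\|$ is the Euclidean norm and $\Pi_{\mathcal{P}}(y)=\arg\min_{x\in\mathcal{P}}\frac12\|x-y\|^2$ is the Euclidean projection. The normal cone at $x\in\mathcal{P}$ is $N_{\mathcal{P}}(x)=\{y\in\mathbb{R}^n:\langle y,z-x\rangle\le0\ \forall z\in\mathcal{P}\}$. The breakpoints $x_1,\dots,x_k$ are the successive end points of the maximal $\lambda$-intervals on which $g$ is affine and non-constant ($k=0$ is allowed, when $g$ is constant equal to $x_0$). *)

theory Defs
  imports "HOL-Analysis.Analysis"
begin

definition normal_cone :: "(real^'n) set \<Rightarrow> real^'n \<Rightarrow> (real^'n) set" where
  "normal_cone P x = {y. \<forall>z\<in>P. y \<bullet> (z - x) \<le> 0}"

definition projections_curve ::
    "(real^'n) set \<Rightarrow> real^'n \<Rightarrow> real^'n \<Rightarrow> real \<Rightarrow> real^'n" where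
  "projections_curve P x0 w l = closest_point P (x0 - l *\<^sub>R w)"

definition affine_nonconstant_on :: "real set \<Rightarrow> (real \<Rightarrow> real^'n) \<Rightarrow> bool" where
  "affine_nonconstant_on I g \<longleftrightarrow>
     (\<exists>c v. \<forall>l\<in>I. g l = c + l *\<^sub>R v) \<and> \<not> g constant_on I"

text \<open>Curves are parametrised by the nonnegative reals, so only subintervals of
  \<open>{0..}\<close> compete for maximality.  Intervals may be open, closed or unbounded.\<close>

definition maximal_affine_piece :: "(real \<Rightarrow> real^'n) \<Rightarrow> real set \<Rightarrow> bool" where
  "maximal_affine_piece g I \<longleftrightarrow>
     is_interval I \<and> I \<subseteq> {0..} \<and> affine_nonconstant_on I g \<and>
     (\<forall>J. is_interval J \<and> J \<subseteq> {0..} \<and> affine_nonconstant_on J g \<and> I \<subseteq> J \<longrightarrow> J = I)"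

text \<open>The data of the breakpoint decomposition of a curve: \<open>lm i\<close> and \<open>lp i\<close> are the
  first and the last parameter at which the curve is at \<open>x i\<close>.  The last parameter of
  the end point \<open>x k\<close> is infinite: the curve stays at \<open>x k\<close> from \<open>lm k\<close> on, and the real
  number \<open>lp k\<close> is not used.  The last clause says that \<open>x 1, \<dots>, x k\<close> are
  exactly the end points of the maximal affine nonconstant pieces, so that \<open>k\<close>, \<open>x\<close>, \<open>lm\<close>
  and \<open>lp\<close> are determined by the curve (for the indices that are used).\<close>

definition breakpoint_decomposition ::
    "(real \<Rightarrow> real^'n) \<Rightarrow> nat \<Rightarrow> (nat \<Rightarrow> real^'n) \<Rightarrow> (nat \<Rightarrow> real) \<Rightarrow> (nat \<Rightarrow> real) \<Rightarrow> bool" where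
  "breakpoint_decomposition g k x lm lp \<longleftrightarrow>
     lm 0 = 0 \<and>
     (\<forall>i<k. lm i \<le> lp i) \<and>
     (\<forall>i\<in>{1..k}. lp (i - 1) < lm i) \<and>
     (\<forall>i\<le>k. lm i \<in> {l. 0 \<le> l \<and> g l = x i} \<and>
             (\<forall>l\<in>{l. 0 \<le> l \<and> g l = x i}. lm i \<le> l)) \<and>
     (\<forall>i<k. lp i \<in> {l. 0 \<le> l \<and> g l = x i} \<and>
             (\<forall>l\<in>{l. 0 \<le> l \<and> g l = x i}. l \<le> lp i)) \<and>
     (\<forall>i<k. \<forall>l\<in>{lm i..lp i}. g l = x i) \<and>
     (\<forall>l\<ge>lm k. g l = x k) \<and>
     (\<forall>i\<in>{1..k}. \<forall>l\<in>{lp (i - 1)..lm i}.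
        g l = x (i - 1) + (l - lp (i - 1)) *\<^sub>R ((x i - x (i - 1)) /\<^sub>R (lm i - lp (i - 1)))) \<and>
     {I. maximal_affine_piece g I} = (\<lambda>i. {lp (i - 1)..lm i}) ` {1..k}"

end

theory Submission
  imports Defs
begin

text \<open>
  A normal cone does not change along the inside of a segment: a linear functional that is maximal
  over \<open>P\<close> at an inner point of a segment of \<open>P\<close> is constant on the segment, so
  the cone there is the intersection of the cones at the two ends (\<open>normal_cone_between\<close>).
  Now \<open>g l\<close> is the point of \<open>P\<close> with \<open>x0 - l w - g l\<close> in its normal
  cone. If the cones at \<open>g l\<close> and \<open>g l'\<close> agree, then, cones being convex, every
  convex combination of \<open>g l\<close> and \<open>g l'\<close> satisfies this condition at the same
  convex combination of \<open>l\<close> and \<open>l'\<close>: the curve runs affinely from \<open>g l\<close> to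
  \<open>g l'\<close>, and the cone stays the same on the way (\<open>projections_curve_chord\<close>).

  A normal cone is determined by the smallest face that contains the point, so there are at most as
  many cones as faces (\<open>card_normal_cones_le_faces\<close>). Hence the parameters split into finitely
  many intervals, one for each cone, with \<open>g\<close> affine on each of them. The remaining step is
  about curves alone, with the normal cone as a label (\<open>breakpoint_decomposition_exists\<close>).
  The maximal affine nonconstant pieces of a bounded continuous curve are compact intervals, and two
  of them overlap in at most one point. Their midpoints have distinct labels, since otherwise the
  curve would be affine from one midpoint to the other and the two pieces would be one; this bounds
  their number. On an interval that shares no more than a point with each of the pieces, the curve is
  constant on each label class, so it takes finitely many values there and is constant, being
  continuous. Listing the pieces from left to right yields the breakpoints.

  Each piece runs along a segment of \<open>P\<close>, so the cone along the piece is the intersection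
  of the cones at its ends. It differs from the cone at a start where the curve has rested, since
  otherwise the curve would be affine from the beginning of the rest on and could not move later.
  At the end point the condition on the cone holds for all large \<open>l\<close>; dividing it by
  \<open>l\<close> shows that the end point minimizes \<open>\<lambda>y. y \<bullet> w\<close>, and restricting it to the
  other minimizers shows that it is the one nearest to \<open>x0\<close>
  (\<open>projections_curve_limit_is_arg_min\<close>).
\<close>

section \<open>Normal cones, faces and projections\<close>

text \<open>
  A linear functional that attains its maximum over \<open>P\<close> at an inner point of a segment
  takes the same value at both ends of the segment.
\<close>

lemma normal_cone_between:
  fixes p q :: "real^'n"
  assumes "p \<in> P" "q \<in> P" "0 < u" "u < 1"
  shows "normal_cone P (u *\<^sub>R p + (1 - u) *\<^sub>R q) = normal_cone P p \<inter> normal_cone P q"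
proof (intro set_eqI iffI IntI)
  let ?z = "u *\<^sub>R p + (1 - u) *\<^sub>R q"
  fix y assume "y \<in> normal_cone P ?z"
  then have le: "y \<bullet> (r - ?z) \<le> 0" if "r \<in> P" for r
    using that by (auto simp: normal_cone_def)
  have "p - ?z = (1 - u) *\<^sub>R (p - q)" "q - ?z = u *\<^sub>R (q - p)"
    by (simp_all add: algebra_simps)
  with le[OF assms(1)] le[OF assms(2)] have "(1 - u) * (y \<bullet> (p - q)) \<le> 0" "u * (y \<bullet> (q - p)) \<le> 0"
    by simp_all
  then have "y \<bullet> p = y \<bullet> q"
    using assms(3,4) by (simp add: mult_le_0_iff inner_diff_right)
  moreover from this have "y \<bullet> ?z = y \<bullet> q"
    by (simp add: inner_add_right algebra_simps)
  ultimately show "y \<in> normal_cone P p" "y \<in> normal_cone P q"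
    using le by (simp_all add: normal_cone_def inner_diff_right)
next
  let ?z = "u *\<^sub>R p + (1 - u) *\<^sub>R q"
  fix y assume y: "y \<in> normal_cone P p \<inter> normal_cone P q"
  show "y \<in> normal_cone P ?z"
    unfolding normal_cone_def
  proof (intro CollectI ballI)
    fix r assume "r \<in> P"
    have "r - ?z = u *\<^sub>R (r - p) + (1 - u) *\<^sub>R (r - q)"
      by (simp add: algebra_simps)
    then have "y \<bullet> (r - ?z) = u * (y \<bullet> (r - p)) + (1 - u) * (y \<bullet> (r - q))"
      by (simp add: inner_add_right)
    moreover have "y \<bullet> (r - p) \<le> 0" "y \<bullet> (r - q) \<le> 0"
      using y \<open>r \<in> P\<close> by (auto simp: normal_cone_def)
    ultimately show "y \<bullet> (r - ?z) \<le> 0"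
      using assms(3,4) by (simp add: add_nonpos_nonpos mult_le_0_iff)
  qed
qed

lemma normal_cone_convex_comb:
  assumes "y \<in> normal_cone P x" "y' \<in> normal_cone P x" "0 \<le> u" "u \<le> 1"
  shows "u *\<^sub>R y + (1 - u) *\<^sub>R y' \<in> normal_cone P x"
proof -
  have "u * (y \<bullet> (z - x)) + (1 - u) * (y' \<bullet> (z - x)) \<le> 0" if "z \<in> P" for z
    using assms that
    by (intro add_nonpos_nonpos mult_nonneg_nonpos) (auto simp: normal_cone_def)
  then show ?thesis
    by (simp add: normal_cone_def inner_add_left)
qed

text \<open>
  The variational inequality characterizes projections: adding the inequalities of two points that
  satisfy it shows that their squared distance is at most zero.
\<close>

lemma closest_point_eq_iff_normal_cone:
  fixes P :: "(real^'n) set"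
  assumes "closed P" "convex P" "p \<in> P"
  shows "closest_point P y = p \<longleftrightarrow> y - p \<in> normal_cone P p"
proof
  assume "closest_point P y = p"
  then show "y - p \<in> normal_cone P p"
    using closest_point_dot[OF assms(2,1)] by (auto simp: normal_cone_def)
next
  let ?q = "closest_point P y"
  assume "y - p \<in> normal_cone P p"
  moreover have "?q \<in> P"
    using closest_point_in_set[OF assms(1)] assms(3) by auto
  ultimately have "(y - p) \<bullet> (?q - p) \<le> 0"
    by (auto simp: normal_cone_def)
  moreover have "(y - ?q) \<bullet> (p - ?q) \<le> 0"
    by (rule closest_point_dot[OF assms(2,1,3)])
  moreover have "(p - ?q) \<bullet> (p - ?q) = (y - ?q) \<bullet> (p - ?q) + (y - p) \<bullet> (?q - p)"
    by (simp add: algebra_simps inner_diff_left inner_diff_right inner_commute)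
  ultimately have "(p - ?q) \<bullet> (p - ?q) \<le> 0"
    by linarith
  then have "p - ?q = 0"
    by (metis inner_eq_zero_iff inner_ge_zero order_antisym)
  then show "?q = p"
    by simp
qed

text \<open>
  The normal cone at \<open>x\<close> can be recovered from the smallest face that contains \<open>x\<close>,
  as the set of functionals that are maximal over \<open>P\<close> at every point of this face.
\<close>

lemma card_normal_cones_le_faces:
  fixes P :: "(real^'n) set"
  assumes "polytope P" "A \<subseteq> P"
  shows "finite (normal_cone P ` A)"
    and "card (normal_cone P ` A) \<le> card {F. F face_of P \<and> F \<noteq> {}}"
proof -
  let ?faces = "{F. F face_of P \<and> F \<noteq> {}}"
  define cone where "cone F = {y. \<forall>z\<in>P. \<forall>f\<in>F. y \<bullet> (z - f) \<le> 0}" for F :: "(real^'n) set"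
  have conv: "convex P"
    using assms(1) polytope_imp_convex by blast
  have "normal_cone P x \<in> cone ` ?faces" if "x \<in> P" for x
  proof
    \<comment> \<open>The face that contains \<open>x\<close> in its relative interior.\<close>
    define F where "F = (\<Inter>y\<in>normal_cone P x. P \<inter> {z. y \<bullet> z = y \<bullet> x})"
    have zero: "0 \<in> normal_cone P x"
      by (simp add: normal_cone_def)
    have "P \<inter> {z. y \<bullet> z = y \<bullet> x} face_of P" if "y \<in> normal_cone P x" for y
      using conv that
      by (intro face_of_Int_supporting_hyperplane_le) (auto simp: normal_cone_def inner_diff_right)
    then have "F face_of P"
      unfolding F_def using zero by (intro face_of_Inter) auto
    moreover have xF: "x \<in> F"
      using that by (simp add: F_def)
    ultimately show "F \<in> ?faces"
      by blast
    show "normal_cone P x = cone F"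
    proof
      show "cone F \<subseteq> normal_cone P x"
        using xF by (auto simp: cone_def normal_cone_def)
      show "normal_cone P x \<subseteq> cone F"
        by (auto simp: cone_def F_def inner_diff_right) (auto simp: normal_cone_def inner_diff_right)
    qed
  qed
  then have sub: "normal_cone P ` A \<subseteq> cone ` ?faces"
    using assms(2) by blast
  have fin: "finite ?faces"
    by (rule finite_subset[OF _ finite_polytope_faces[OF assms(1)]]) auto
  show "finite (normal_cone P ` A)"
    by (rule finite_subset[OF sub]) (simp add: fin)
  show "card (normal_cone P ` A) \<le> card ?faces"
    by (rule surj_card_le[OF fin sub])
qed

section \<open>Maximal affine pieces of a curve\<close>

lemma affine_nonconstant_onE:
  assumes "affine_nonconstant_on I g"
  obtains c v p q where "\<And>l. l \<in> I \<Longrightarrow> g l = c + l *\<^sub>R v" "v \<noteq> 0" "p \<in> I" "q \<in> I" "p < q"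
proof -
  obtain c v where cv: "\<And>l. l \<in> I \<Longrightarrow> g l = c + l *\<^sub>R v" and nc: "\<not> g constant_on I"
    using assms unfolding affine_nonconstant_on_def by blast
  have "v \<noteq> 0"
    using nc cv by (auto simp: constant_on_def)
  moreover obtain r where "r \<in> I"
    using nc by (auto simp: constant_on_def)
  moreover obtain r' where "r' \<in> I" "g r' \<noteq> g r"
    using nc unfolding constant_on_def by blast
  ultimately show thesis
    using that[OF cv] by (metis linorder_neqE)
qed

lemma affine_nonconstant_onI:
  assumes "\<And>l. l \<in> I \<Longrightarrow> g l = c + l *\<^sub>R v" "v \<noteq> 0" "p \<in> I" "q \<in> I" "p < q"
  shows "affine_nonconstant_on I g"
proof -
  have "g p \<noteq> g q"
    using assms by simp
  then have "\<not> g constant_on I"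
    using assms(3,4) unfolding constant_on_def by metis
  then show ?thesis
    unfolding affine_nonconstant_on_def using assms(1) by blast
qed

lemma affine_function_unique:
  fixes c v c' v' :: "'a::real_vector"
  assumes "c + p *\<^sub>R v = c' + p *\<^sub>R v'" "c + q *\<^sub>R v = c' + q *\<^sub>R v'" "p \<noteq> q"
  shows "c' = c" "v' = v"
proof -
  have "(q - p) *\<^sub>R v = (c + q *\<^sub>R v) - (c + p *\<^sub>R v)"
    by (simp add: algebra_simps)
  also have "\<dots> = (q - p) *\<^sub>R v'"
    unfolding assms(1,2) by (simp add: algebra_simps)
  finally show "v' = v"
    using assms(3) by simp
  then show "c' = c"
    using assms(1) by simp
qed

text \<open>
  All affine pieces that contain \<open>I\<close> follow the line that the curve follows on \<open>I\<close>, and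
  they share the points of \<open>I\<close>; so their union is itself an affine piece, the largest one.
\<close>

lemma affine_piece_extends:
  assumes "is_interval I" "I \<subseteq> {0..}" "affine_nonconstant_on I g"
  obtains J where "maximal_affine_piece g J" "I \<subseteq> J"
proof -
  define K where "K = {J. is_interval J \<and> J \<subseteq> {0..} \<and> affine_nonconstant_on J g \<and> I \<subseteq> J}"
  obtain c v p q where cv: "\<And>l. l \<in> I \<Longrightarrow> g l = c + l *\<^sub>R v" and pq: "v \<noteq> 0" "p \<in> I" "q \<in> I" "p < q"
    using affine_nonconstant_onE[OF assms(3)] by metis
  have I: "I \<in> K"
    using assms by (simp add: K_def)
  \<comment> \<open>Every piece containing \<open>I\<close> follows the line that \<open>g\<close> follows on \<open>I\<close>.\<close>
  have "g l = c + l *\<^sub>R v" if "J \<in> K" "l \<in> J" for J l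
  proof -
    obtain c' v' where cv': "\<And>l. l \<in> J \<Longrightarrow> g l = c' + l *\<^sub>R v'"
      using \<open>J \<in> K\<close> unfolding K_def affine_nonconstant_on_def by blast
    have "p \<in> J" "q \<in> J"
      using \<open>J \<in> K\<close> pq by (auto simp: K_def)
    then have "c + p *\<^sub>R v = c' + p *\<^sub>R v'" "c + q *\<^sub>R v = c' + q *\<^sub>R v'"
      using cv[OF pq(2)] cv[OF pq(3)] cv' by auto
    then have "c' = c" "v' = v"
      using affine_function_unique pq(4) by (metis less_irrefl)+
    then show ?thesis
      using cv' \<open>l \<in> J\<close> by simp
  qed
  then have line: "g l = c + l *\<^sub>R v" if "l \<in> \<Union>K" for l
    using that by blast
  have "p \<in> \<Inter>K"
    using pq(2) by (auto simp: K_def)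
  then have "connected (\<Union>K)"
    by (intro connected_Union) (auto simp: K_def is_interval_connected_1)
  moreover have "affine_nonconstant_on (\<Union>K) g"
    using affine_nonconstant_onI[OF line pq(1)] I pq by blast
  moreover have "\<Union>K \<subseteq> {0..}" "I \<subseteq> \<Union>K"
    using I by (auto simp: K_def)
  moreover have "J = \<Union>K"
    if "is_interval J" "J \<subseteq> {0..}" "affine_nonconstant_on J g" "\<Union>K \<subseteq> J" for J
  proof -
    have "J \<in> K"
      using that \<open>I \<subseteq> \<Union>K\<close> by (simp add: K_def)
    then show ?thesis
      using that(4) by blast
  qed
  ultimately show thesis
    using that[of "\<Union>K"] by (simp add: maximal_affine_piece_def is_interval_connected_1)
qed

lemma affine_nonconstant_on_Un:
  assumes "affine_nonconstant_on I g" "\<And>l. l \<in> J \<Longrightarrow> g l = c' + l *\<^sub>R v'"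
    and "p \<in> I \<inter> J" "q \<in> I \<inter> J" "p < q"
  shows "affine_nonconstant_on (I \<union> J) g"
proof -
  obtain c v where cv: "\<And>l. l \<in> I \<Longrightarrow> g l = c + l *\<^sub>R v" and "v \<noteq> 0"
    using affine_nonconstant_onE[OF assms(1)] by metis
  have "c + p *\<^sub>R v = c' + p *\<^sub>R v'" "c + q *\<^sub>R v = c' + q *\<^sub>R v'"
    using assms(2-4) cv by (metis IntD1 IntD2)+
  then have "c' = c" "v' = v"
    using affine_function_unique assms(5) by (metis less_irrefl)+
  then have "g l = c + l *\<^sub>R v" if "l \<in> I \<union> J" for l
    using that cv assms(2) by blast
  then show ?thesis
    using affine_nonconstant_onI \<open>v \<noteq> 0\<close> assms(3-5) by blast
qed

text \<open>
  Two points of overlap force the two lines to coincide, so the union of both intervals is an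
  affine piece, which maximality of \<open>I\<close> identifies with \<open>I\<close>.
\<close>

lemma affine_interval_overlap_subset:
  assumes I: "maximal_affine_piece g I"
    and J: "is_interval J" "J \<subseteq> {0..}" "\<And>l. l \<in> J \<Longrightarrow> g l = c + l *\<^sub>R v"
    and pq: "p \<in> I \<inter> J" "q \<in> I \<inter> J" "p < q"
  shows "J \<subseteq> I"
proof -
  have "affine_nonconstant_on (I \<union> J) g"
    using affine_nonconstant_on_Un[OF _ J(3) pq] I by (simp add: maximal_affine_piece_def)
  moreover have "is_interval (I \<union> J)"
    using I J(1) pq(1) connected_Un[of I J] by (auto simp: maximal_affine_piece_def is_interval_connected_1)
  moreover have "I \<union> J \<subseteq> {0..}"
    using I J(2) by (simp add: maximal_affine_piece_def)
  ultimately have "I \<union> J = I"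
    using I unfolding maximal_affine_piece_def by blast
  then show ?thesis
    by blast
qed

lemma maximal_affine_pieces_overlap_eq:
  assumes I: "maximal_affine_piece g I" and J: "maximal_affine_piece g J"
    and pq: "p \<in> I \<inter> J" "q \<in> I \<inter> J" "p < q"
  shows "I = J"
proof -
  have sub: "B \<subseteq> A"
    if "maximal_affine_piece g A" "maximal_affine_piece g B" "p \<in> A \<inter> B" "q \<in> A \<inter> B" for A B
  proof -
    have B: "is_interval B" "B \<subseteq> {0..}" and "affine_nonconstant_on B g"
      using that(2) by (simp_all add: maximal_affine_piece_def)
    then obtain c v where "\<And>l. l \<in> B \<Longrightarrow> g l = c + l *\<^sub>R v"
      unfolding affine_nonconstant_on_def by blast
    then show ?thesis
      using affine_interval_overlap_subset[OF that(1) B _ that(3,4) pq(3)] by blast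
  qed
  show ?thesis
    using sub[OF I J] sub[OF J I] pq by blast
qed

text \<open>
  A bounded curve cannot follow a line at nonzero speed forever, and by continuity the curve still
  follows the line at the end points of the interval, which therefore belong to a maximal piece.
\<close>

lemma maximal_affine_piece_compact:
  assumes I: "maximal_affine_piece g I"
    and cont: "continuous_on {0..} g" and bdd: "bounded (g ` {0..})"
  obtains s t where "I = {s..t}" "0 \<le> s" "s < t"
proof -
  obtain c v p q where cv: "\<And>l. l \<in> I \<Longrightarrow> g l = c + l *\<^sub>R v" and pq: "v \<noteq> 0" "p \<in> I" "q \<in> I" "p < q"
    using affine_nonconstant_onE I unfolding maximal_affine_piece_def by metis
  have I': "is_interval I" "I \<subseteq> {0..}"
    using I by (simp_all add: maximal_affine_piece_def)
  have cl0: "closure I \<subseteq> {0..}"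
    using I'(2) by (simp add: closure_minimal)
  have line: "g l = c + l *\<^sub>R v" if "l \<in> closure I" for l
  proof -
    have "continuous_on (closure I) (\<lambda>l. g l - l *\<^sub>R v)"
      using continuous_on_subset[OF cont cl0] by (intro continuous_intros)
    then have "g l - l *\<^sub>R v = c"
      by (rule continuous_constant_on_closure) (use cv that in auto)
    then show ?thesis
      by (simp add: algebra_simps)
  qed
  have "closure I = I"
  proof -
    have "affine_nonconstant_on (closure I) g"
      using affine_nonconstant_onI[OF line pq(1)] pq closure_subset by blast
    moreover have "is_interval (closure I)"
      using I'(1) connected_imp_connected_closure by (auto simp: is_interval_connected_1)
    ultimately show ?thesis
      using I cl0 closure_subset unfolding maximal_affine_piece_def by blast
  qed
  then have "closed I"
    by (metis closed_closure)
  moreover have "bounded I"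
  proof -
    obtain B where B: "\<And>l. 0 \<le> l \<Longrightarrow> norm (g l) \<le> B"
      using bdd by (auto simp: bounded_iff)
    have "norm l \<le> (B + norm c) / norm v" if "l \<in> I" for l
    proof -
      have "norm (l *\<^sub>R v) = norm (g l - c)"
        using cv[OF that] by simp
      also have "\<dots> \<le> norm (g l) + norm c"
        by (rule norm_triangle_ineq4)
      also have "\<dots> \<le> B + norm c"
        using B that I'(2) by auto
      finally show ?thesis
        using pq(1) by (simp add: field_simps)
    qed
    then show ?thesis
      unfolding bounded_iff by blast
  qed
  ultimately have "compact I" "connected I"
    using I'(1) by (simp_all add: compact_eq_bounded_closed is_interval_connected_1)
  then obtain s t where "I = {s..t}"
    using connected_compact_interval_1 by blast
  then show thesis
    using that[of s t] pq I'(2) by auto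
qed

section \<open>Curves that are affine along each label\<close>

text \<open>
  The properties of the normal cones along a projections curve on which its breakpoints depend:
  only finitely many labels occur, and between two parameters with the same label the curve traverses
  a segment at constant speed without changing its label. A label belongs to a point and not to a
  parameter, so a curve that returns to a point has not left it in the meantime.
\<close>

locale label_affine_curve =
  fixes g :: "real \<Rightarrow> real^'n" and N :: "real^'n \<Rightarrow> 'c"
  assumes cont: "continuous_on {0..} g"
    and bdd: "bounded (g ` {0..})"
    and fin: "finite (N ` g ` {0..})"
    and chord: "\<lbrakk>0 \<le> l; l < l'; N (g l) = N (g l'); d \<in> {0..1}\<rbrakk>
        \<Longrightarrow> g (d * l + (1 - d) * l') = d *\<^sub>R g l + (1 - d) *\<^sub>R g l'"
    and chord_label: "\<lbrakk>0 \<le> l; l < l'; N (g l) = N (g l'); d \<in> {0..1}\<rbrakk>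
        \<Longrightarrow> N (d *\<^sub>R g l + (1 - d) *\<^sub>R g l') = N (g l)"
begin

lemma chord_affine:
  assumes "0 \<le> l" "l < l'" "N (g l) = N (g l')" "u \<in> {l..l'}"
  defines "v \<equiv> (g l' - g l) /\<^sub>R (l' - l)"
  shows "g u = (g l - l *\<^sub>R v) + u *\<^sub>R v" and "N (g u) = N (g l)"
proof -
  define d where "d = (l' - u) / (l' - l)"
  have "d * (l' - l) = l' - u"
    using assms(2) by (simp add: d_def)
  then have d: "d \<in> {0..1}" "d * l + (1 - d) * l' = u"
    using assms(2,4) by (simp_all add: algebra_simps) (simp add: d_def)
  have "g u = d *\<^sub>R g l + (1 - d) *\<^sub>R g l'"
    using chord[OF assms(1-3) d(1)] d(2) by simp
  then show "N (g u) = N (g l)"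
    using chord_label[OF assms(1-3) d(1)] by simp
  have "1 - d = (u - l) / (l' - l)"
    using assms(2) by (simp add: d_def field_simps)
  then have "(u - l) *\<^sub>R v = (1 - d) *\<^sub>R (g l' - g l)"
    by (simp add: v_def divide_inverse)
  moreover have "g u = g l + (1 - d) *\<^sub>R (g l' - g l)"
    using \<open>g u = d *\<^sub>R g l + (1 - d) *\<^sub>R g l'\<close> by (simp add: algebra_simps)
  ultimately have "g u = g l + (u - l) *\<^sub>R v"
    by simp
  then show "g u = (g l - l *\<^sub>R v) + u *\<^sub>R v"
    by (simp add: scaleR_diff_left)
qed

lemma constant_between:
  assumes "0 \<le> l" "g l = g l'" "u \<in> {l..l'}"
  shows "g u = g l"
proof (cases "l < l'")
  case True
  then show ?thesis
    using chord_affine(1)[OF assms(1) True _ assms(3)] assms(2) by simp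
next
  case False
  then have "u = l"
    using assms(3) by auto
  then show ?thesis
    by simp
qed

lemma label_class_affine:
  assumes "0 \<le> u"
  shows "is_interval {l\<in>{u..v}. N (g l) = y}"
    and "\<exists>c w. \<forall>l\<in>{l\<in>{u..v}. N (g l) = y}. g l = c + l *\<^sub>R w"
proof -
  let ?S = "{l\<in>{u..v}. N (g l) = y}"
  show "is_interval ?S"
    unfolding is_interval_1
  proof (intro ballI allI impI)
    fix p q r assume pq: "p \<in> ?S" "q \<in> ?S" "p \<le> r \<and> r \<le> q"
    have "N (g r) = y"
    proof (cases "p < q")
      case True
      then show ?thesis
        using chord_affine(2)[of p q r] pq assms by auto
    next
      case False
      then have "r = p"
        using pq by auto
      then show ?thesis
        using pq by simp
    qed
    then show "r \<in> ?S"
      using pq by auto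
  qed
  show "\<exists>c w. \<forall>l\<in>?S. g l = c + l *\<^sub>R w"
  proof (cases "\<exists>p\<in>?S. \<exists>q\<in>?S. p < q")
    case False
    then have single: "p = q" if "p \<in> ?S" "q \<in> ?S" for p q
      using that by (meson linorder_neqE)
    have "\<forall>l\<in>?S. g l = g (SOME p. p \<in> ?S) + l *\<^sub>R 0"
    proof
      fix l assume l: "l \<in> ?S"
      have "l = (SOME p. p \<in> ?S)"
        by (rule single[OF l someI[of "\<lambda>p. p \<in> ?S", OF l]])
      then show "g l = g (SOME p. p \<in> ?S) + l *\<^sub>R 0"
        by simp
    qed
    then show ?thesis
      by (intro exI)
  next
    case True
    then obtain p q where pq: "p \<in> ?S" "q \<in> ?S" "p < q"
      by (elim bexE)
    have between: "\<exists>c w. \<forall>l\<in>{s..t}. g l = c + l *\<^sub>R w" if "s \<in> ?S" "t \<in> ?S" "s < t" for s t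
    proof -
      have "0 \<le> s" "N (g s) = N (g t)"
        using that assms by auto
      then show ?thesis
        using chord_affine(1)[of s t] that(3) by (intro exI ballI)
    qed
    obtain c w where cw: "\<forall>l\<in>{p..q}. g l = c + l *\<^sub>R w"
      using between[OF pq] by (elim exE)
    have "g l = c + l *\<^sub>R w" if l: "l \<in> ?S" for l
    proof -
      \<comment> \<open>The chord over the hull of \<open>l, p, q\<close> extends the chord over \<open>{p..q}\<close>.\<close>
      define s t where "s = min l p" and "t = max l q"
      have st: "s \<in> ?S" "t \<in> ?S" "s < t" and "l \<in> {s..t}" "p \<in> {s..t}" "q \<in> {s..t}"
        using l pq by (auto simp: s_def t_def min_def max_def)
      obtain c' w' where c'w': "\<forall>l\<in>{s..t}. g l = c' + l *\<^sub>R w'"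
        using between[OF st] by (elim exE)
      have "c + p *\<^sub>R w = c' + p *\<^sub>R w'" "c + q *\<^sub>R w = c' + q *\<^sub>R w'"
        using cw c'w' pq(3) \<open>p \<in> {s..t}\<close> \<open>q \<in> {s..t}\<close> by simp_all
      then have "c' = c" "w' = w"
        using affine_function_unique[of c p w c' w' q] pq(3) by auto
      then show ?thesis
        using c'w' \<open>l \<in> {s..t}\<close> by simp
    qed
    then show ?thesis
      by (intro exI ballI)
  qed
qed

text \<open>
  A curve that is constant on each of finitely many label classes has finitely many values, and a
  finite connected set has at most one element.
\<close>

lemma constant_on_label_class_imp_constant:
  assumes "0 \<le> u" and const: "\<And>y. g constant_on {l\<in>{u..v}. N (g l) = y}"
  shows "g constant_on {u..v}"
proof -
  have "\<exists>f. \<forall>l\<in>{u..v}. g l = f (N (g l))"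
  proof -
    have "\<forall>y. \<exists>z. \<forall>l\<in>{l\<in>{u..v}. N (g l) = y}. g l = z"
      using const unfolding constant_on_def by blast
    then obtain f where "\<forall>y. \<forall>l\<in>{l\<in>{u..v}. N (g l) = y}. g l = f y"
      by metis
    then have "\<forall>l\<in>{u..v}. g l = f (N (g l))"
      by simp
    then show ?thesis
      by (rule exI[of _ f])
  qed
  then obtain f where f: "\<And>l. l \<in> {u..v} \<Longrightarrow> g l = f (N (g l))"
    by blast
  have "finite (g ` {u..v})"
  proof (rule finite_subset)
    show "g ` {u..v} \<subseteq> f ` N ` g ` {0..}"
      using f assms(1) by (force simp: image_iff)
  qed (simp add: fin)
  moreover have "connected (g ` {u..v})"
    using assms(1) by (intro connected_continuous_image continuous_on_subset[OF cont]) auto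
  ultimately have "g ` {u..v} = {} \<or> (\<exists>z. g ` {u..v} = {z})"
    using connected_finite_iff_sing by blast
  then show ?thesis
    unfolding constant_on_def by blast
qed

text \<open>
  Movement on an interval shows up on one of the label classes, where the curve is affine; this
  affine interval extends to a maximal one.
\<close>

lemma nonconstant_meets_maximal_piece:
  assumes "0 \<le> u" "\<not> g constant_on {u..v}"
  obtains I p q where "maximal_affine_piece g I" "p \<in> I \<inter> {u..v}" "q \<in> I \<inter> {u..v}" "p < q"
proof -
  obtain y where y: "\<not> g constant_on {l\<in>{u..v}. N (g l) = y}"
    using constant_on_label_class_imp_constant assms by blast
  let ?S = "{l\<in>{u..v}. N (g l) = y}"
  have an: "affine_nonconstant_on ?S g"
    using label_class_affine(2)[OF assms(1)] y unfolding affine_nonconstant_on_def by blast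
  have "?S \<subseteq> {0..}"
    using assms(1) by auto
  then obtain J where "maximal_affine_piece g J" "?S \<subseteq> J"
    by (rule affine_piece_extends[OF label_class_affine(1)[OF assms(1)] _ an])
  moreover obtain p q where "p \<in> ?S" "q \<in> ?S" "p < q"
    by (rule affine_nonconstant_onE[OF an])
  ultimately show thesis
    using that[of J p q] by blast
qed

lemma piece_interval:
  assumes "maximal_affine_piece g I"
  obtains s t where "I = {s..t}" "0 \<le> s" "s < t"
  using maximal_affine_piece_compact[OF assms cont bdd] .

lemma piece_injective:
  assumes "maximal_affine_piece g {s..t}" "p \<in> {s..t}" "q \<in> {s..t}" "g p = g q"
  shows "p = q"
proof -
  have "affine_nonconstant_on {s..t} g"
    using assms(1) by (simp add: maximal_affine_piece_def)
  then show ?thesis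
  proof (rule affine_nonconstant_onE)
    fix c v assume "\<And>l. l \<in> {s..t} \<Longrightarrow> g l = c + l *\<^sub>R v" "v \<noteq> 0"
    with assms(2-4) show ?thesis
      by simp
  qed
qed

text \<open>
  Midpoints of distinct pieces carry distinct labels: with equal labels the curve would be affine
  between the midpoints, so this interval, which overlaps both pieces, would lie in both of them.
\<close>

lemma finite_card_maximal_pieces:
  shows "finite {I. maximal_affine_piece g I}"
    and "card {I. maximal_affine_piece g I} \<le> card (N ` g ` {0..})"
proof -
  let ?M = "{I. maximal_affine_piece g I}"
  let ?mid = "\<lambda>I. (Inf I + Sup I) / 2 :: real"
  have eq: "{s..t} = {s'..t'}"
    if pieces: "maximal_affine_piece g {s..t}" "maximal_affine_piece g {s'..t'}"
      and order: "0 \<le> s" "s < t" "s' < t'" "(s + t) / 2 \<le> (s' + t') / 2"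
      and label: "N (g ((s + t) / 2)) = N (g ((s' + t') / 2))" for s t s' t'
  proof -
    define m m' where "m = (s + t) / 2" and "m' = (s' + t') / 2"
    have mid: "0 \<le> m" "s < m" "m < t" "s' < m'" "m' < t'"
      using order by (simp_all add: m_def m'_def)
    show ?thesis
    proof (cases "m = m'")
      case True
      show ?thesis
        by (rule maximal_affine_pieces_overlap_eq[OF pieces, of m "min t t'"]) (use mid True in auto)
    next
      case False
      then have "m < m'"
        using order by (simp add: m_def m'_def)
      have "N (g m) = N (g m')"
        using label by (simp add: m_def m'_def)
      note line = chord_affine(1)[OF \<open>0 \<le> m\<close> \<open>m < m'\<close> this]
      have "{m..m'} \<subseteq> {s..t}"
        by (rule affine_interval_overlap_subset[OF pieces(1) _ _ line, where J = "{m..m'}" and p = m and q = "min t m'"])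
          (use mid \<open>m < m'\<close> in \<open>auto simp: is_interval_cc\<close>)
      then have "m' \<in> {s..t}"
        using \<open>m < m'\<close> by auto
      then show ?thesis
        by (intro maximal_affine_pieces_overlap_eq[OF pieces, of "max m s'" m'])
          (use mid \<open>m < m'\<close> in auto)
    qed
  qed
  have inj: "inj_on (\<lambda>I. N (g (?mid I))) ?M"
  proof (rule inj_onI)
    fix I J assume IJ: "I \<in> ?M" "J \<in> ?M" and label: "N (g (?mid I)) = N (g (?mid J))"
    obtain s t where I: "I = {s..t}" "0 \<le> s" "s < t"
      using IJ(1) piece_interval by blast
    obtain s' t' where J: "J = {s'..t'}" "0 \<le> s'" "s' < t'"
      using IJ(2) piece_interval by blast
    have "?mid I = (s + t) / 2" "?mid J = (s' + t') / 2"
      using I J by simp_all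
    then show "I = J"
      using eq[of s t s' t'] eq[of s' t' s t] IJ I J label by (metis linorder_linear mem_Collect_eq)
  qed
  have "0 \<le> ?mid I" if I: "I \<in> ?M" for I
  proof -
    obtain s t where "I = {s..t}" "0 \<le> s" "s < t"
      using I piece_interval by blast
    then show ?thesis
      by simp
  qed
  then have sub: "(\<lambda>I. N (g (?mid I))) ` ?M \<subseteq> N ` g ` {0..}"
    by auto
  show "finite ?M"
    using inj_on_finite[OF inj sub fin] .
  show "card ?M \<le> card (N ` g ` {0..})"
    using card_inj_on_le[OF inj sub fin] .
qed

theorem breakpoint_decomposition_exists:
  obtains k x lm lp where "x 0 = g 0" "breakpoint_decomposition g k x lm lp"
    "k \<le> card (N ` g ` {0..})"
proof -
  let ?M = "{I. maximal_affine_piece g I}"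
  define L where "L = Inf ` ?M"
  define k where "k = card L"
  define s where "s i = sorted_list_of_set L ! i" for i
  define t where "t i = (THE r. maximal_affine_piece g {s i..r})" for i
  have finM: "finite ?M"
    by (rule finite_card_maximal_pieces(1))
  then have finL: "finite L"
    by (simp add: L_def)
  have "k \<le> card ?M"
    unfolding k_def L_def by (rule card_image_le[OF finM])
  then have k_le: "k \<le> card (N ` g ` {0..})"
    using finite_card_maximal_pieces(2) by linarith
  have len: "length (sorted_list_of_set L) = k"
    by (simp add: k_def)
  have s_mono: "s i < s j" if "i < j" "j < k" for i j
    using that len sorted_wrt_nth_less[OF strict_sorted_list_of_set[of L], of i j] by (simp add: s_def)
  have s_range: "s ` {..<k} = L"
  proof -
    have "L = set (sorted_list_of_set L)"
      using finL by simp
    also have "\<dots> = s ` {..<k}"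
      using len by (auto simp: set_conv_nth s_def)
    finally show ?thesis ..
  qed
  \<comment> \<open>A maximal piece is determined by its left end point.\<close>
  have right_unique: "r = r'"
    if pieces: "maximal_affine_piece g {a..r}" "maximal_affine_piece g {a..r'}" for a r r'
  proof -
    have "a < r" "a < r'"
      using piece_interval[OF pieces(1)] piece_interval[OF pieces(2)]
      by (metis Icc_eq_Icc not_less order.asym order.strict_implies_order)+
    then have "{a..r} = {a..r'}"
      by (intro maximal_affine_pieces_overlap_eq[OF pieces, of a "min r r'"]) auto
    then show ?thesis
      using \<open>a < r\<close> \<open>a < r'\<close> by (simp add: Icc_eq_Icc)
  qed
  have piece: "maximal_affine_piece g {s i..t i}" and s_nonneg: "0 \<le> s i" and s_less_t: "s i < t i"
    if "i < k" for i
  proof -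
    have "s i \<in> L"
      using s_range that by blast
    then obtain I where I: "maximal_affine_piece g I" "s i = Inf I"
      by (auto simp: L_def)
    obtain a r where ar: "I = {a..r}" "0 \<le> a" "a < r"
      using piece_interval[OF I(1)] .
    then have "s i = a"
      using I(2) by simp
    moreover have "t i = r"
      unfolding t_def using I(1) ar \<open>s i = a\<close> right_unique by (intro the_equality) auto
    ultimately show "maximal_affine_piece g {s i..t i}" "0 \<le> s i" "s i < t i"
      using I ar by simp_all
  qed
  have pieces: "?M = (\<lambda>i. {s i..t i}) ` {..<k}"
  proof
    show "(\<lambda>i. {s i..t i}) ` {..<k} \<subseteq> ?M"
      using piece by blast
    show "?M \<subseteq> (\<lambda>i. {s i..t i}) ` {..<k}"
    proof
      fix I assume "I \<in> ?M"
      then have I: "maximal_affine_piece g I"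
        by simp
      obtain a r where ar: "I = {a..r}" "0 \<le> a" "a < r"
        using piece_interval[OF I] .
      have "Inf I \<in> L"
        using I by (auto simp: L_def)
      then obtain i where i: "i < k" "s i = a"
        using s_range ar by (auto simp: image_iff)
      then have "t i = r"
        using piece[OF i(1)] I ar right_unique by metis
      then show "I \<in> (\<lambda>i. {s i..t i}) ` {..<k}"
        using i ar by auto
    qed
  qed
  have t_le_s: "t i \<le> s j" if "i < j" "j < k" for i j
  proof (rule ccontr)
    assume "\<not> t i \<le> s j"
    moreover have "i < k" "s i < s j"
      using that s_mono by simp_all
    moreover have "s j < t j"
      using s_less_t that by blast
    ultimately have "{s i..t i} = {s j..t j}"
      by (intro maximal_affine_pieces_overlap_eq[OF piece piece, of i j "s j" "min (t i) (t j)"])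
        (use that in auto)
    then show False
      using \<open>s i < s j\<close> s_less_t[OF \<open>i < k\<close>] by (simp add: Icc_eq_Icc)
  qed
  have t_mono: "t i \<le> t j" if "i \<le> j" "j < k" for i j
    using t_le_s[of i j] s_less_t[of j] that by (cases "i = j") auto
  define lm where "lm i = (if i = 0 then 0 else t (i - 1))" for i
  define x where "x i = g (lm i)" for i
  have lm_nonneg: "0 \<le> lm i" if "i \<le> k" for i
    using that s_nonneg[of "i - 1"] s_less_t[of "i - 1"] by (cases i) (auto simp: lm_def)
  have lm_le_s: "lm i \<le> s i" if "i < k" for i
    using that s_nonneg t_le_s[of "i - 1" i] by (auto simp: lm_def)
  \<comment> \<open>Between consecutive pieces, and after the last one, the curve rests: any movement
    there would belong to a further maximal piece.\<close>
  have rest: "g l = x i" if i: "i \<le> k" and "lm i \<le> l" and before: "i < k \<Longrightarrow> l \<le> s i" for i l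
  proof -
    have "g constant_on {lm i..l}"
    proof (rule ccontr)
      assume "\<not> g constant_on {lm i..l}"
      then obtain I p q where I: "maximal_affine_piece g I"
        and pq: "p \<in> I \<inter> {lm i..l}" "q \<in> I \<inter> {lm i..l}" "p < q"
        by (rule nonconstant_meets_maximal_piece[OF lm_nonneg[OF i]])
      then obtain j where j: "j < k" "I = {s j..t j}"
        using pieces by blast
      show False
      proof (cases "j < i")
        case True
        then have "t j \<le> lm i"
          using t_mono[of j "i - 1"] i by (auto simp: lm_def)
        then show False
          using pq j(2) by auto
      next
        case False
        then have "i < k" "s i \<le> s j"
          using j(1) s_mono[of i j] by (cases "i = j"; auto)+
        then have "q \<le> s j"
          using pq before by auto
        then show False
          using pq j(2) by auto
      qed
    qed
    then show ?thesis
      using \<open>lm i \<le> l\<close> unfolding x_def constant_on_def by force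
  qed
  have lm_min: "lm i \<le> l" if "i \<le> k" "0 \<le> l" "g l = x i" for i l
  proof (cases "i = 0")
    case False
    then have i: "i - 1 < k" "lm i = t (i - 1)"
      using that(1) by (auto simp: lm_def)
    show ?thesis
    proof (rule ccontr)
      assume "\<not> lm i \<le> l"
      then have "max l (s (i - 1)) < t (i - 1)"
        using i s_less_t by simp
      moreover from this have "g (max l (s (i - 1))) = g (t (i - 1))"
        using constant_between[of l "t (i - 1)" "max l (s (i - 1))"] that i by (simp add: x_def)
      ultimately show False
        using piece_injective[OF piece[OF i(1)], of "max l (s (i - 1))" "t (i - 1)"] by auto
    qed
  qed (use that in \<open>simp add: lm_def\<close>)
  have s_max: "l \<le> s i" if "i < k" "0 \<le> l" "g l = x i" for i l
  proof (rule ccontr)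
    assume "\<not> l \<le> s i"
    then have "s i < min l (t i)"
      using s_less_t that by simp
    moreover have "g (s i) = g l"
      using rest[of i "s i"] lm_le_s that by simp
    ultimately have "g (min l (t i)) = g (s i)"
      using constant_between[of "s i" l "min l (t i)"] s_nonneg that by simp
    then show False
      using piece_injective[OF piece[OF that(1)], of "min l (t i)" "s i"] \<open>s i < min l (t i)\<close> by auto
  qed
  have line: "g l = x (i - 1) + (l - s (i - 1)) *\<^sub>R ((x i - x (i - 1)) /\<^sub>R (lm i - s (i - 1)))"
    if "i \<in> {1..k}" "l \<in> {s (i - 1)..lm i}" for i l
  proof -
    have i: "i - 1 < k" "lm i = t (i - 1)"
      using that(1) by (auto simp: lm_def)
    have "affine_nonconstant_on {s (i - 1)..t (i - 1)} g"
      using piece[OF i(1)] by (simp only: maximal_affine_piece_def)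
    then obtain c v where cv: "\<forall>l\<in>{s (i - 1)..t (i - 1)}. g l = c + l *\<^sub>R v"
      unfolding affine_nonconstant_on_def by (elim conjE exE)
    have less: "s (i - 1) < lm i"
      using s_less_t i by simp
    have "x (i - 1) = g (s (i - 1))"
      using rest[of "i - 1" "s (i - 1)"] lm_le_s i by simp
    then have start: "x (i - 1) = c + s (i - 1) *\<^sub>R v"
      using cv less i by simp
    have "x i = c + lm i *\<^sub>R v"
      using cv less i by (simp add: x_def)
    then have "x i - x (i - 1) = (lm i - s (i - 1)) *\<^sub>R v"
      using start by (simp add: algebra_simps)
    then have "(x i - x (i - 1)) /\<^sub>R (lm i - s (i - 1)) = v"
      using less by simp
    then show ?thesis
      using cv that(2) i start by (simp add: algebra_simps)
  qed
  have "breakpoint_decomposition g k x lm s"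
    unfolding breakpoint_decomposition_def
  proof (intro conjI)
    show "{I. maximal_affine_piece g I} = (\<lambda>i. {s (i - 1)..lm i}) ` {1..k}"
    proof -
      have "{1..k} = Suc ` {..<k}"
        by (simp add: lessThan_atLeast0 atLeastLessThanSuc_atLeastAtMost)
      then show ?thesis
        unfolding pieces by (simp add: image_image lm_def)
    qed
    show "\<forall>i\<in>{1..k}. s (i - 1) < lm i"
      using s_less_t by (auto simp: lm_def)
    show "\<forall>i\<le>k. lm i \<in> {l. 0 \<le> l \<and> g l = x i} \<and> (\<forall>l\<in>{l. 0 \<le> l \<and> g l = x i}. lm i \<le> l)"
      using lm_nonneg lm_min by (simp add: x_def)
    show "\<forall>i<k. s i \<in> {l. 0 \<le> l \<and> g l = x i} \<and> (\<forall>l\<in>{l. 0 \<le> l \<and> g l = x i}. l \<le> s i)"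
      using s_nonneg s_max rest lm_le_s by simp
  qed (use lm_le_s rest line in \<open>auto simp: lm_def\<close>)
  moreover have "x 0 = g 0"
    by (simp add: x_def lm_def)
  ultimately show thesis
    using that k_le by blast
qed

end

section \<open>The projections curve\<close>

lemma projections_curve_properties:
  fixes P :: "(real^'n) set"
  assumes "closed P" "convex P" "P \<noteq> {}"
  shows "projections_curve P x0 w l \<in> P"
    and "x0 - l *\<^sub>R w - projections_curve P x0 w l \<in> normal_cone P (projections_curve P x0 w l)"
    and "continuous_on A (projections_curve P x0 w)"
proof -
  show P: "projections_curve P x0 w l \<in> P"
    using closest_point_in_set[OF assms(1,3)] by (simp add: projections_curve_def)
  show "x0 - l *\<^sub>R w - projections_curve P x0 w l \<in> normal_cone P (projections_curve P x0 w l)"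
    using closest_point_eq_iff_normal_cone[OF assms(1,2) P, of "x0 - l *\<^sub>R w"]
    by (simp add: projections_curve_def)
  have "continuous_on A (closest_point P \<circ> (\<lambda>l. x0 - l *\<^sub>R w))"
    by (intro continuous_on_compose continuous_on_closest_point[OF assms(2,1,3)] continuous_intros)
  moreover have "projections_curve P x0 w = closest_point P \<circ> (\<lambda>l. x0 - l *\<^sub>R w)"
    by (simp add: fun_eq_iff projections_curve_def)
  ultimately show "continuous_on A (projections_curve P x0 w)"
    by simp
qed

lemma projections_curve_chord:
  fixes P :: "(real^'n) set"
  assumes P: "closed P" "convex P" "P \<noteq> {}"
    and g_eq: "g = projections_curve P x0 w"
    and cones: "normal_cone P (g l) = normal_cone P (g l')"
    and d: "d \<in> {0..1}"
  shows "g (d * l + (1 - d) * l') = d *\<^sub>R g l + (1 - d) *\<^sub>R g l'"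
    and "normal_cone P (d *\<^sub>R g l + (1 - d) *\<^sub>R g l') = normal_cone P (g l)"
proof -
  let ?p = "d *\<^sub>R g l + (1 - d) *\<^sub>R g l'"
  have gP: "g r \<in> P" and gN: "x0 - r *\<^sub>R w - g r \<in> normal_cone P (g r)" for r
    unfolding g_eq using projections_curve_properties(1,2)[OF P] by blast+
  show eq: "normal_cone P ?p = normal_cone P (g l)"
  proof (cases "0 < d \<and> d < 1")
    case True
    then show ?thesis
      using normal_cone_between[OF gP gP] cones by simp
  next
    case False
    then have "d = 0 \<or> d = 1"
      using d by auto
    then show ?thesis
      using cones by (elim disjE) simp_all
  qed
  have pP: "?p \<in> P"
    using d P(2) gP by (auto intro: convexD)
  let ?y = "x0 - (d * l + (1 - d) * l') *\<^sub>R w"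
  have "?y - ?p = d *\<^sub>R (x0 - l *\<^sub>R w - g l) + (1 - d) *\<^sub>R (x0 - l' *\<^sub>R w - g l')"
    by (simp add: algebra_simps)
  also have "\<dots> \<in> normal_cone P ?p"
    unfolding eq using d gN[of l] gN[of l'] cones by (intro normal_cone_convex_comb) auto
  finally have "closest_point P ?y = ?p"
    using closest_point_eq_iff_normal_cone[OF P(1,2) pP] by blast
  then show "g (d * l + (1 - d) * l') = ?p"
    by (simp add: g_eq projections_curve_def)
qed

text \<open>
  The variational inequality at \<open>q\<close> holds for all large \<open>l\<close>. The term with the
  factor \<open>l\<close> forces \<open>w \<bullet> (z - q) \<ge> 0\<close>. Where this product vanishes, what remains is the
  variational inequality of \<open>q\<close> as the projection of \<open>x0\<close> on the set of minimizers.
\<close>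

lemma projections_curve_limit_is_arg_min:
  fixes P :: "(real^'n) set"
  assumes P: "closed P" "convex P" "P \<noteq> {}"
    and stays: "\<And>l. l \<ge> r \<Longrightarrow> projections_curve P x0 w l = q"
  shows "is_arg_min (\<lambda>y. y \<bullet> w) (\<lambda>y. y \<in> P) q"
    and "is_arg_min (\<lambda>y. norm (y - x0)) (is_arg_min (\<lambda>y. y \<bullet> w) (\<lambda>y. y \<in> P)) q"
proof -
  have qP: "q \<in> P"
    using stays[of r] projections_curve_properties(1)[OF P] by (metis order_refl)
  have vi: "(x0 - q) \<bullet> (z - q) \<le> l * (w \<bullet> (z - q))" if "r \<le> l" "z \<in> P" for l z
  proof -
    have "x0 - l *\<^sub>R w - q \<in> normal_cone P q"
      using projections_curve_properties(2)[OF P, of x0 l w] stays[OF that(1)] by simp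
    then have "(x0 - l *\<^sub>R w - q) \<bullet> (z - q) \<le> 0"
      using that(2) by (auto simp: normal_cone_def)
    then show ?thesis
      by (simp add: inner_diff_left algebra_simps)
  qed
  have min: "q \<bullet> w \<le> z \<bullet> w" if "z \<in> P" for z
  proof (rule ccontr)
    assume "\<not> q \<bullet> w \<le> z \<bullet> w"
    then have neg: "w \<bullet> (z - q) < 0"
      by (simp add: inner_diff_right inner_commute)
    define A where "A = (x0 - q) \<bullet> (z - q)"
    define l where "l = max r ((A - 1) / (w \<bullet> (z - q)))"
    have "l * (w \<bullet> (z - q)) \<le> (A - 1) / (w \<bullet> (z - q)) * (w \<bullet> (z - q))"
      using neg by (intro mult_right_mono_neg) (auto simp: l_def)
    also have "\<dots> = A - 1"
      using neg by simp
    finally show False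
      using vi[of l z] that by (simp add: l_def A_def)
  qed
  show arg: "is_arg_min (\<lambda>y. y \<bullet> w) (\<lambda>y. y \<in> P) q"
    using qP min by (force simp: is_arg_min_def)
  have "norm (q - x0) \<le> norm (z - x0)" if z: "is_arg_min (\<lambda>y. y \<bullet> w) (\<lambda>y. y \<in> P) z" for z
  proof -
    have zP: "z \<in> P" and "z \<bullet> w = q \<bullet> w"
      using z qP min[of z] by (auto simp: is_arg_min_def not_less intro: antisym)
    then have "(x0 - q) \<bullet> (z - q) \<le> 0"
      using vi[of r z] by (simp add: inner_diff_right inner_commute)
    moreover have "(z - x0) \<bullet> (z - x0) =
        (q - x0) \<bullet> (q - x0) + (z - q) \<bullet> (z - q) - 2 * ((x0 - q) \<bullet> (z - q))"
      by (simp add: inner_diff_left inner_diff_right inner_commute algebra_simps)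
    moreover have "0 \<le> (z - q) \<bullet> (z - q)"
      by (rule inner_ge_zero)
    ultimately have "(q - x0) \<bullet> (q - x0) \<le> (z - x0) \<bullet> (z - x0)"
      by linarith
    then show ?thesis
      by (simp add: norm_le)
  qed
  then show "is_arg_min (\<lambda>y. norm (y - x0)) (is_arg_min (\<lambda>y. y \<bullet> w) (\<lambda>y. y \<in> P)) q"
    using arg unfolding is_arg_min_def by (metis (no_types, lifting) not_less)
qed

theorem theorem2:
  fixes a :: "nat \<Rightarrow> real^'n" and b :: "nat \<Rightarrow> real" and m :: nat
    and P :: "(real^'n) set" and x0 w :: "real^'n" and g :: "real \<Rightarrow> real^'n"
  assumes P_eq: "P = {x. \<forall>i\<in>{1..m}. a i \<bullet> x \<le> b i}"
    and polytope: "polytope P"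
    and x0_in: "x0 \<in> P"
    and g_eq: "g = projections_curve P x0 w"
  shows "\<exists>(k::nat) (x :: nat \<Rightarrow> real^'n) (lm :: nat \<Rightarrow> real) (lp :: nat \<Rightarrow> real).
     x 0 = x0 \<and> (\<forall>i\<in>{1..k}. x i \<in> P) \<and>
     breakpoint_decomposition g k x lm lp \<and>
     (\<forall>i\<in>{1..k}. \<forall>l\<in>{lp (i - 1)<..<lm i}. \<forall>l'\<in>{lp (i - 1)<..<lm i}.
        (normal_cone P (x (i - 1)) = normal_cone P (g (lp (i - 1))) \<and>
         normal_cone P (g l) \<subseteq> normal_cone P (g (lp (i - 1))) \<and>
         (lm (i - 1) < lp (i - 1) \<longrightarrow> normal_cone P (g l) \<subset> normal_cone P (g (lp (i - 1))))) \<and>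
        normal_cone P (g l) = normal_cone P (g l') \<and>
        (normal_cone P (g l) \<subseteq> normal_cone P (g (lm i)) \<and>
         normal_cone P (g (lm i)) = normal_cone P (x i))) \<and>
     (\<forall>l l'. 0 \<le> l \<and> l < l' \<and> normal_cone P (g l) = normal_cone P (g l') \<longrightarrow>
        (\<forall>d\<in>{0..1}. g (d * l + (1 - d) * l') = d *\<^sub>R g l + (1 - d) *\<^sub>R g l')) \<and>
     k \<le> card {F. F face_of P \<and> F \<noteq> {}} \<and>
     (g \<longlongrightarrow> x k) at_top \<and>
     is_arg_min (\<lambda>y. y \<bullet> w) (\<lambda>y. y \<in> P) (x k) \<and>
     is_arg_min (\<lambda>y. norm (y - x0)) (is_arg_min (\<lambda>y. y \<bullet> w) (\<lambda>y. y \<in> P)) (x k)"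
proof -
  have P: "closed P" "convex P" "P \<noteq> {}" "bounded P"
    using polytope x0_in by (auto simp: polytope_imp_closed polytope_imp_convex polytope_imp_bounded)
  have gP: "g l \<in> P" for l
    unfolding g_eq using projections_curve_properties(1)[OF P(1-3)] .
  have chord: "g (d * l + (1 - d) * l') = d *\<^sub>R g l + (1 - d) *\<^sub>R g l'"
    and chord_cone: "normal_cone P (d *\<^sub>R g l + (1 - d) *\<^sub>R g l') = normal_cone P (g l)"
    if "normal_cone P (g l) = normal_cone P (g l')" "d \<in> {0..1}" for l l' d
    using projections_curve_chord[OF P(1-3) g_eq that] by blast+
  have "g ` {0..} \<subseteq> P"
    using gP by blast
  note cones = card_normal_cones_le_faces[OF polytope this]
  interpret label_affine_curve g "normal_cone P"
  proof
    show "continuous_on {0..} g"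
      unfolding g_eq by (rule projections_curve_properties(3)[OF P(1-3)])
    show "bounded (g ` {0..})"
      using P(4) \<open>g ` {0..} \<subseteq> P\<close> by (rule bounded_subset)
  qed (use cones chord chord_cone in auto)
  obtain k x lm lp where x0: "x 0 = g 0" and dec: "breakpoint_decomposition g k x lm lp"
    and k: "k \<le> card (normal_cone P ` g ` {0..})"
    using breakpoint_decomposition_exists .
  have "g 0 = x0"
    using x0_in by (simp add: g_eq projections_curve_def closest_point_self)
  with x0 have start: "x 0 = x0"
    by simp
  have first: "\<forall>i\<le>k. lm i \<in> {l. 0 \<le> l \<and> g l = x i} \<and> (\<forall>l\<in>{l. 0 \<le> l \<and> g l = x i}. lm i \<le> l)"
    and last: "\<forall>i<k. lp i \<in> {l. 0 \<le> l \<and> g l = x i} \<and> (\<forall>l\<in>{l. 0 \<le> l \<and> g l = x i}. l \<le> lp i)"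
    and stays: "\<forall>l\<ge>lm k. g l = x k"
    and line: "\<forall>i\<in>{1..k}. \<forall>l\<in>{lp (i - 1)..lm i}.
      g l = x (i - 1) + (l - lp (i - 1)) *\<^sub>R ((x i - x (i - 1)) /\<^sub>R (lm i - lp (i - 1)))"
    using dec unfolding breakpoint_decomposition_def by - (elim conjE, assumption)+
  have x_lm: "x i = g (lm i)" and lm_nonneg: "0 \<le> lm i" if "i \<le> k" for i
    using first that by simp_all
  have x_lp: "x i = g (lp i)" and lp_max: "\<And>l. 0 \<le> l \<Longrightarrow> g l = x i \<Longrightarrow> l \<le> lp i" if "i < k" for i
    using last that by simp_all
  have xP: "x i \<in> P" if "i \<le> k" for i
    using x_lm[OF that] gP by simp
  have cone_piece: "normal_cone P (g l) = normal_cone P (x (i - 1)) \<inter> normal_cone P (x i)"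
    if i: "i \<in> {1..k}" and l: "l \<in> {lp (i - 1)<..<lm i}" for i l
  proof -
    define u where "u = (lm i - l) / (lm i - lp (i - 1))"
    have u: "0 < u" "u < 1" "1 - u = (l - lp (i - 1)) / (lm i - lp (i - 1))"
      using l by (auto simp: u_def field_simps)
    have "g l = x (i - 1) + (1 - u) *\<^sub>R (x i - x (i - 1))"
      using line i l u(3) by (simp add: divide_inverse)
    also have "\<dots> = u *\<^sub>R x (i - 1) + (1 - u) *\<^sub>R x i"
      by (simp add: algebra_simps)
    finally show ?thesis
      using normal_cone_between[OF xP xP u(1,2), of "i - 1" i] i by auto
  qed
  \<comment> \<open>If the cone were the same after the curve has left a resting point, the curve would be
    affine from the start of the rest on, so it would still be resting.\<close>
  have strict: "normal_cone P (g l) \<noteq> normal_cone P (x (i - 1))"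
    if i: "i \<in> {1..k}" and l: "l \<in> {lp (i - 1)<..<lm i}" and wait: "lm (i - 1) < lp (i - 1)" for i l
  proof
    assume same: "normal_cone P (g l) = normal_cone P (x (i - 1))"
    define j where "j = i - 1"
    have j: "j < k" "lm j < lp j" "lp j < l" "0 \<le> lm j"
      using i l wait lm_nonneg[of "i - 1"] by (auto simp: j_def)
    have xj: "x j = g (lm j)" "x j = g (lp j)"
      using x_lm x_lp j(1) by simp_all
    have cone: "normal_cone P (g (lm j)) = normal_cone P (g l)"
      using same xj by (simp add: j_def)
    define v where "v = (g l - g (lm j)) /\<^sub>R (l - lm j)"
    have "g (lp j) = g (lm j) - lm j *\<^sub>R v + lp j *\<^sub>R v"
      unfolding v_def using chord_affine(1)[OF j(4) _ cone, of "lp j"] j by simp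
    then have "(lp j - lm j) *\<^sub>R v = 0"
      using xj by (auto simp: algebra_simps)
    then have "v = 0"
      using j by simp
    then have "g l = x j"
      using j xj by (simp add: v_def)
    then show False
      using lp_max[OF j(1), of l] j by simp
  qed
  have lim: "(g \<longlongrightarrow> x k) at_top"
  proof (rule tendsto_eventually)
    show "\<forall>\<^sub>F l in at_top. g l = x k"
      using stays by (auto simp: eventually_at_top_linorder)
  qed
  have min: "is_arg_min (\<lambda>y. y \<bullet> w) (\<lambda>y. y \<in> P) (x k)"
    "is_arg_min (\<lambda>y. norm (y - x0)) (is_arg_min (\<lambda>y. y \<bullet> w) (\<lambda>y. y \<in> P)) (x k)"
    using projections_curve_limit_is_arg_min[OF P(1-3), of "lm k" x0 w "x k"] stays
    by (simp_all add: g_eq)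
  have k_faces: "k \<le> card {F. F face_of P \<and> F \<noteq> {}}"
    using k cones(2) by linarith
  have parts: "\<forall>i\<in>{1..k}. \<forall>l\<in>{lp (i - 1)<..<lm i}. \<forall>l'\<in>{lp (i - 1)<..<lm i}.
        (normal_cone P (x (i - 1)) = normal_cone P (g (lp (i - 1))) \<and>
         normal_cone P (g l) \<subseteq> normal_cone P (g (lp (i - 1))) \<and>
         (lm (i - 1) < lp (i - 1) \<longrightarrow> normal_cone P (g l) \<subset> normal_cone P (g (lp (i - 1))))) \<and>
        normal_cone P (g l) = normal_cone P (g l') \<and>
        (normal_cone P (g l) \<subseteq> normal_cone P (g (lm i)) \<and>
         normal_cone P (g (lm i)) = normal_cone P (x i))"
  proof (intro ballI)
    fix i l l' assume i: "i \<in> {1..k}" and l: "l \<in> {lp (i - 1)<..<lm i}" and l': "l' \<in> {lp (i - 1)<..<lm i}"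
    have ends: "g (lp (i - 1)) = x (i - 1)" "g (lm i) = x i"
      using x_lp[of "i - 1"] x_lm[of i] i by auto
    show "(normal_cone P (x (i - 1)) = normal_cone P (g (lp (i - 1))) \<and>
         normal_cone P (g l) \<subseteq> normal_cone P (g (lp (i - 1))) \<and>
         (lm (i - 1) < lp (i - 1) \<longrightarrow> normal_cone P (g l) \<subset> normal_cone P (g (lp (i - 1))))) \<and>
        normal_cone P (g l) = normal_cone P (g l') \<and>
        (normal_cone P (g l) \<subseteq> normal_cone P (g (lm i)) \<and>
         normal_cone P (g (lm i)) = normal_cone P (x i))"
      unfolding ends using cone_piece[OF i l] cone_piece[OF i l'] strict[OF i l] by blast
  qed
  have points: "\<forall>i\<in>{1..k}. x i \<in> P"
    using xP by simp
  have chords: "\<forall>l l'. 0 \<le> l \<and> l < l' \<and> normal_cone P (g l) = normal_cone P (g l') \<longrightarrow>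
      (\<forall>d\<in>{0..1}. g (d * l + (1 - d) * l') = d *\<^sub>R g l + (1 - d) *\<^sub>R g l')"
    by (intro allI impI ballI, elim conjE) (rule chord)
  show ?thesis
    by (rule exI[of _ k], rule exI[of _ x], rule exI[of _ lm], rule exI[of _ lp])
      (intro conjI start points dec parts chords k_faces lim min)
qed

end
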